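(* Let $T,K\in\mathbb N$ and $1<a\le e$. The function $F_{T,K,a}:\mathbb R^T\to\mathbb R$ defined in the context satisfies: 1. $F_{T,K,a}(0)-\inf_{x\in\mathbb R^T}F_{T,K,a}(x)\le\Delta^0(K,a)\cdot T$, where $\Delta^0(K,a):=\sqrt{2\pi e}\cdot a^K$. 2. $F_{T,K,a}$ is $\ell_1(K,a)$-smooth, i.e. its gradient is $\ell_1(K,a)$-Lipschitz in the Euclidean norm, where $\ell_1(K,a):=12\sqrt{2\pi}\,e^{5/2}\cdot\frac{K^2a^K}{\log a}$. 3. For all $x\in\mathbb R^T$, $\|\nabla F_{T,K,a}(x)\|_\infty\le\gamma_\infty(K,a)$, where $\gamma_\infty(K,a):=6\sqrt{2\pi}\,e^{3/2}\cdot\frac{Ka^K}{\sqrt{\log a}}$.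
   Context: $\mathbb N=\{1,2,\dots\}$. For $x=(x_1,\dots,x_T)\in\mathbb R^T$ set by convention $x_0=x_{-1}=\dots=x_{-K+1}\equiv1$. Define $$F_{T,K,a}(x)=-\sum_{i=1}^T\Psi_a(x_{i-K})\cdots\Psi_a(x_{i-2})\Psi_a(x_{i-1})\Phi(x_i)+\sum_{i=1}^T\Gamma(x_i),$$ where $$\Psi_a(x)=\begin{cases}0,&x\le 1/2,\\ \exp\!\left(\log a\cdot\left(1-\frac{1}{(2x-1)^2}\right)\right),&x>1/2,\end{cases}\qquad \Phi(x)=\sqrt e\int_{-\infty}^x e^{-t^2/2}\,dt,\qquad \Gamma(x)=\begin{cases}-x\,e^{1/x+1},&x<0,\\0,&x\ge0.\end{cases}$$ *)

theory Defs
  imports "HOL-Analysis.Analysis"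
begin

definition Psi :: "real \<Rightarrow> real \<Rightarrow> real" where
  "Psi a x = (if x \<le> 1/2 then 0 else exp (ln a * (1 - 1 / (2 * x - 1)^2)))"

definition Phi :: "real \<Rightarrow> real" where
  "Phi x = sqrt (exp 1) * integral {..x} (\<lambda>t. exp (- (t^2 / 2)))"

definition Gam :: "real \<Rightarrow> real" where
  "Gam x = (if x < 0 then - x * exp (1 / x + 1) else 0)"

(* A point of R^T is a vector x :: real ^ 'n together with an enumeration e of its
   coordinates by {1..T}: x_k is x $ e k for 1 \<le> k \<le> T, and x_k = 1 for k \<le> 0. *)
definition coord :: "(nat \<Rightarrow> 'n) \<Rightarrow> real ^ 'n \<Rightarrow> int \<Rightarrow> real" where
  "coord e x k = (if k \<le> 0 then 1 else x $ e (nat k))"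

definition F :: "(nat \<Rightarrow> 'n) \<Rightarrow> nat \<Rightarrow> nat \<Rightarrow> real \<Rightarrow> real ^ 'n \<Rightarrow> real" where
  "F e T K a x =
     - (\<Sum>i = 1..T. (\<Prod>j = 1..K. Psi a (coord e x (int i - int j))) * Phi (coord e x (int i)))
     + (\<Sum>i = 1..T. Gam (coord e x (int i)))"

(* Meaningful only where f is differentiable. *)
definition gradient :: "('a::real_inner \<Rightarrow> real) \<Rightarrow> 'a \<Rightarrow> 'a" where
  "gradient f x = (THE D. GDERIV f x :> D)"

definition smooth_with :: "real \<Rightarrow> ('a::real_inner \<Rightarrow> real) \<Rightarrow> bool" where
  "smooth_with L f \<longleftrightarrow>
     (\<forall>x. GDERIV f x :> gradient f x) \<and> L-lipschitz_on UNIV (gradient f)"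

definition Delta0 :: "nat \<Rightarrow> real \<Rightarrow> real" where
  "Delta0 K a = sqrt (2 * pi * exp 1) * a ^ K"

definition ell1 :: "nat \<Rightarrow> real \<Rightarrow> real" where
  "ell1 K a = 12 * sqrt (2 * pi) * exp (5/2) * ((real K)^2 * a ^ K / ln a)"

definition gamma_inf :: "nat \<Rightarrow> real \<Rightarrow> real" where
  "gamma_inf K a = 6 * sqrt (2 * pi) * exp (3/2) * (real K * a ^ K / sqrt (ln a))"

end

theory Submission
  imports Defs "HOL-Probability.Distributions"
begin

text \<open>
  The Hessian is avoided altogether.  With \<open>s = ln a / (2 x - 1)\<^sup>2\<close> all estimates on \<open>Psi\<close> reduce
  to bounds on \<open>s ^ n * exp (- s)\<close>, and with \<open>r = 1 / sqrt (ln a)\<close> every factor of a summand of \<open>F\<close>,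
  relative to its own supremum, is bounded by 1, is \<open>2 r\<close>-Lipschitz and has a \<open>28 r\<^sup>2\<close>-Lipschitz
  derivative.  The product rule writes the gradient as \<open>K + 1\<close> families, one for each position \<open>j\<close> of
  the differentiated factor.  Within such a family the summands point in distinct coordinate
  directions, so its Euclidean norm is at most the \<open>\<ell>\<^sub>2\<close> norm of its coefficients; these are Lipschitz
  in a window of coordinates, and each shift of the window costs at most the norm of \<open>x - y\<close>.
\<close>

section \<open>Elementary bounds on \<open>s ^ n * exp (- s)\<close>\<close>

lemma exp_one_ge_five_halves: "5/2 \<le> exp (1::real)"
  using exp_lower_Taylor_quadratic[of 1] by simp

text \<open>Apply \<open>1 + u \<le> exp u\<close> at \<open>u = s/n - 1\<close> to get
  \<open>exp 1 * (s/n) \<le> exp (s/n)\<close>, replace \<open>exp 1\<close> by 5/2, and take n-th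
  powers. The resulting bound \<open>(2 n / 5) ^ n\<close> for \<open>s ^ n * exp (- s)\<close> is a
  rational substitute for the maximum \<open>(n / exp 1) ^ n\<close>.\<close>

lemma power_le_exp:
  fixes s :: real
  assumes "0 \<le> s" "1 \<le> n"
  shows "(5 * s / (2 * real n)) ^ n \<le> exp s"
proof -
  let ?t = "s / real n"
  have "5/2 * ?t \<le> exp 1 * ?t"
    using exp_one_ge_five_halves assms by (intro mult_right_mono) auto
  also have "\<dots> \<le> exp 1 * exp (?t - 1)"
    using exp_ge_add_one_self[of "?t - 1"] by (intro mult_left_mono) auto
  also have "\<dots> = exp ?t"
    by (simp flip: exp_add)
  finally have "(5/2 * ?t) ^ n \<le> exp ?t ^ n"
    using assms by (intro power_mono) auto
  also have "exp ?t ^ n = exp s"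
    using assms by (simp flip: exp_of_nat_mult)
  finally show ?thesis
    by (simp add: field_simps)
qed

lemma mult_exp_minus_le:
  fixes s :: real
  assumes "0 \<le> s"
  shows "s * exp (- s) \<le> 2/5"
  using power_le_exp[of s 1] assms by (simp add: exp_minus field_simps)

lemma square_mult_exp_minus_le:
  fixes s :: real
  assumes "0 \<le> s"
  shows "s\<^sup>2 * exp (- s) \<le> 16/25"
  using power_le_exp[of s 2] assms by (simp add: exp_minus field_simps power2_eq_square)

lemma cube_mult_exp_minus_le:
  fixes s :: real
  assumes "0 \<le> s"
  shows "s ^ 3 * exp (- s) \<le> 216/125"
  using power_le_exp[of s 3] assms by (simp add: exp_minus field_simps power3_eq_cube)

section \<open>Functions glued to zero at a point\<close>

lemma has_real_derivative_zero_of_quadratic_bound: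
  fixes f :: "real \<Rightarrow> real"
  assumes "\<And>x. \<bar>f x\<bar> \<le> C * (x - c)\<^sup>2"
  shows "(f has_real_derivative 0) (at c)"
proof -
  have f0: "f c = 0"
    using assms[of c] by simp
  have "((\<lambda>h. f (c + h) / h) \<longlongrightarrow> 0) (at 0)"
  proof (rule Lim_null_comparison)
    show "\<forall>\<^sub>F h in at 0. norm (f (c + h) / h) \<le> C * \<bar>h\<bar>"
      unfolding eventually_at
    proof (intro exI[of _ 1] conjI ballI impI)
      fix h :: real
      assume "h \<noteq> 0 \<and> dist h 0 < 1"
      then show "norm (f (c + h) / h) \<le> C * \<bar>h\<bar>"
        using assms[of "c + h"] by (simp add: divide_le_eq power2_eq_square mult.assoc)
    qed simp
    show "((\<lambda>h. C * \<bar>h\<bar>) \<longlongrightarrow> 0) (at 0)"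
      by (auto intro!: tendsto_eq_intros)
  qed
  then show ?thesis
    using f0 by (simp add: DERIV_def)
qed

text \<open>Two points to the right of \<open>c\<close> are compared by the mean value inequality.
  Points on opposite sides are compared through the linear bound on \<open>f\<close>, since the
  distance of the right point from \<open>c\<close> is at most their mutual distance.\<close>

lemma lipschitz_extend_by_zero:
  fixes f :: "real \<Rightarrow> real"
  assumes zero: "\<And>x. x \<le> c \<Longrightarrow> f x = 0"
    and der: "\<And>x. c < x \<Longrightarrow> (f has_real_derivative f' x) (at x)"
    and der_bound: "\<And>x. c < x \<Longrightarrow> \<bar>f' x\<bar> \<le> C"
    and bound: "\<And>x. c < x \<Longrightarrow> \<bar>f x\<bar> \<le> C * (x - c)"
  shows "\<bar>f x - f y\<bar> \<le> C * \<bar>x - y\<bar>"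
proof -
  have C: "0 \<le> C"
    using der_bound[of "c + 1"] by linarith
  have mixed: "\<bar>f u - f v\<bar> \<le> C * \<bar>u - v\<bar>" if "c < u" "v \<le> c" for u v
  proof -
    have "\<bar>f u - f v\<bar> \<le> C * (u - c)"
      using bound zero that by simp
    also have "\<dots> \<le> C * \<bar>u - v\<bar>"
      using C that by (intro mult_left_mono) auto
    finally show ?thesis .
  qed
  consider "c < x" "c < y" | "c < x" "y \<le> c" | "x \<le> c" "c < y" | "x \<le> c" "y \<le> c"
    by linarith
  then show ?thesis
  proof cases
    case 1
    have "norm (f x - f y) \<le> C * norm (x - y)"
      by (rule field_differentiable_bound[where S = "{c<..}" and f' = f'])
        (use 1 der der_bound in \<open>auto intro: has_field_derivative_at_within\<close>)
    then show ?thesis by simp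
  next
    case 2
    then show ?thesis by (rule mixed)
  next
    case 3
    then show ?thesis using mixed[of y x] by (simp add: abs_minus_commute)
  next
    case 4
    then show ?thesis using zero C by simp
  qed
qed

lemma DERIV_eventually_eq:
  fixes f g :: "real \<Rightarrow> real"
  assumes "(g has_real_derivative D) (at x)" "\<forall>\<^sub>F y in nhds x. f y = g y"
  shows "(f has_real_derivative D) (at x)"
  using DERIV_cong_ev[of x x f g D D] assms by simp

section \<open>Derivative bounds for \<open>Psi\<close>\<close>

definition dPsi :: "real \<Rightarrow> real \<Rightarrow> real" where
  "dPsi a x = (if x \<le> 1/2 then 0 else 4 * ln a / (2 * x - 1) ^ 3 * Psi a x)"

definition dPhi :: "real \<Rightarrow> real" where
  "dPhi x = sqrt (exp 1) * exp (- (x\<^sup>2 / 2))"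

definition dGam :: "real \<Rightarrow> real" where
  "dGam x = (if x < 0 then (1 / x - 1) * exp (1 / x + 1) else 0)"

lemma Psi_nonneg: "0 \<le> Psi a x"
  by (simp add: Psi_def)

lemma Psi_eq:
  assumes "1 < a" "1/2 < x"
  shows "Psi a x = a * exp (- (ln a / (2 * x - 1)\<^sup>2))"
proof -
  have "ln a * (1 - 1 / (2 * x - 1)\<^sup>2) = ln a + - (ln a / (2 * x - 1)\<^sup>2)"
    by (simp add: algebra_simps)
  with assms show ?thesis
    unfolding Psi_def by (simp only: exp_add exp_ln) simp
qed

lemma Psi_le:
  assumes "1 < a"
  shows "Psi a x \<le> a"
proof (cases "x \<le> 1/2")
  case False
  then show ?thesis
    using assms by (simp add: Psi_eq)
qed (use assms in \<open>simp add: Psi_def\<close>)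

lemma dPsi_eq:
  assumes "1 < a" "1/2 < x"
  defines "w \<equiv> 2 * x - 1"
  shows "dPsi a x = 4 * ln a / w ^ 3 * (a * exp (- (ln a / w\<^sup>2)))"
  using assms by (simp add: dPsi_def Psi_eq)

lemma Psi_has_derivative_gt:
  assumes "1 < a" "1/2 < x"
  shows "(Psi a has_real_derivative dPsi a x) (at x)"
proof -
  have "((\<lambda>w. exp (ln a * (1 - 1 / w\<^sup>2))) has_real_derivative
    2 * ln a / w ^ 3 * exp (ln a * (1 - 1 / w\<^sup>2))) (at w)" if "w \<noteq> 0" for w
    using that by (auto intro!: derivative_eq_intros simp: field_simps power2_eq_square power3_eq_cube)
  from this[of "2 * x - 1"]
  have "((\<lambda>w. exp (ln a * (1 - 1 / w\<^sup>2))) has_real_derivative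
    2 * ln a / (2 * x - 1) ^ 3 * Psi a x) (at (2 * x - 1))"
    using assms by (simp add: Psi_def)
  then have "((\<lambda>x. exp (ln a * (1 - 1 / (2 * x - 1)\<^sup>2))) has_real_derivative
    2 * ln a / (2 * x - 1) ^ 3 * Psi a x * 2) (at x)"
    by (rule DERIV_chain2) (auto intro!: derivative_eq_intros)
  then have "((\<lambda>x. exp (ln a * (1 - 1 / (2 * x - 1)\<^sup>2))) has_real_derivative dPsi a x) (at x)"
    using assms by (simp add: dPsi_def mult.assoc)
  moreover have "\<forall>\<^sub>F y in nhds x. Psi a y = exp (ln a * (1 - 1 / (2 * y - 1)\<^sup>2))"
    using eventually_nhds_in_open[of "{1/2<..}" x] assms
    by (auto elim!: eventually_mono simp: Psi_def)
  ultimately show ?thesis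
    by (rule DERIV_eventually_eq)
qed

lemma Psi_has_derivative:
  assumes "1 < a"
  shows "(Psi a has_real_derivative dPsi a x) (at x)"
proof -
  consider "x < 1/2" | "x = 1/2" | "1/2 < x" by linarith
  then show ?thesis
  proof cases
    case 1
    have "((\<lambda>_. 0) has_real_derivative dPsi a x) (at x)"
      using 1 by (simp add: dPsi_def)
    moreover have "\<forall>\<^sub>F y in nhds x. Psi a y = 0"
      using eventually_nhds_in_open[of "{..<1/2}" x] 1
      by (auto elim!: eventually_mono simp: Psi_def)
    ultimately show ?thesis
      by (rule DERIV_eventually_eq)
  next
    case 2
    \<comment> \<open>At the gluing point a quadratic bound suffices: \<open>exp (- s)\<close> is
      \<open>1 / s\<close> times the bounded quantity \<open>s * exp (- s)\<close>, and
      \<open>1 / s\<close> is \<open>(2 y - 1)^2 / ln a\<close>.\<close>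
    have "\<bar>Psi a y\<bar> \<le> 4 * a / ln a * (y - 1/2)\<^sup>2" for y
    proof (cases "y \<le> 1/2")
      case False
      define s where "s = ln a / (2 * y - 1)\<^sup>2"
      have s: "0 < s"
        using False assms by (simp add: s_def)
      have "Psi a y = a / s * (s * exp (- s))"
        using False assms s by (simp add: Psi_eq s_def)
      also have "\<dots> \<le> a / s * (2/5)"
        using mult_exp_minus_le[of s] s assms by (intro mult_left_mono) auto
      also have "\<dots> \<le> a / s"
        using s assms by (intro mult_left_le) auto
      also have "a / s = 4 * a / ln a * (y - 1/2)\<^sup>2"
        using False assms by (simp add: s_def field_simps power2_eq_square)
      finally show ?thesis by (simp add: Psi_nonneg)
    qed (use assms in \<open>simp add: Psi_def\<close>)
    then have "(Psi a has_real_derivative 0) (at (1/2))"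
      by (rule has_real_derivative_zero_of_quadratic_bound)
    with 2 show ?thesis unfolding 2 by (simp add: dPsi_def)
  next
    case 3
    with assms show ?thesis by (rule Psi_has_derivative_gt)
  qed
qed

text \<open>In terms of \<open>s\<close> the derivative contains the half-integer power
  \<open>s^(3/2)\<close>. Squaring both sides leaves \<open>s ^ 3 * exp (- (2 * s))\<close>, to
  which the cubic bound applies at \<open>2 * s\<close>.\<close>

lemma dPsi_bound:
  assumes "1 < a"
  shows "\<bar>dPsi a x\<bar> \<le> a * (2 / sqrt (ln a))"
proof (cases "x \<le> 1/2")
  case False
  define s where "s = ln a / (2 * x - 1)\<^sup>2"
  have s: "0 < s"
    using False assms by (simp add: s_def)
  have "(2 * s) ^ 3 * exp (- (2 * s)) \<le> 216/125"
    using s by (intro cube_mult_exp_minus_le) simp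
  then have cube: "4 * (s ^ 3 * exp (- (2 * s))) \<le> 1"
    by (simp add: power_mult_distrib)
  have "(dPsi a x)\<^sup>2 = a\<^sup>2 * (4 / ln a) * (4 * (s ^ 3 * exp (- (2 * s))))"
  proof -
    have "exp (- (2 * s)) = (exp (- s))\<^sup>2"
      by (simp add: power2_eq_square flip: exp_add)
    then show ?thesis
      using False assms
      by (simp add: dPsi_eq s_def power2_eq_square power3_eq_cube divide_simps)
  qed
  also have "\<dots> \<le> a\<^sup>2 * (4 / ln a)"
    using cube assms by (intro mult_left_le) auto
  also have "\<dots> = (a * (2 / sqrt (ln a)))\<^sup>2"
    using assms by (simp add: power_mult_distrib power_divide)
  finally have "\<bar>dPsi a x\<bar>\<^sup>2 \<le> (a * (2 / sqrt (ln a)))\<^sup>2"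
    by simp
  then show ?thesis
    by (rule power2_le_imp_le) (use assms in auto)
qed (use assms in \<open>simp add: dPsi_def\<close>)

lemma dPsi_lipschitz:
  assumes "1 < a"
  shows "\<bar>dPsi a x - dPsi a y\<bar> \<le> a * (28 / ln a) * \<bar>x - y\<bar>"
proof -
  \<comment> \<open>\<open>d2\<close> is the second derivative of \<open>Psi a\<close> to the right
    of 1/2. The extension-by-zero lemma at \<open>c = 1/2\<close> then asks for a bound on
    \<open>d2\<close> and a linear bound on \<open>dPsi\<close>.\<close>
  define d2 where "d2 x = Psi a x * (16 * (ln a)\<^sup>2 / (2 * x - 1) ^ 6 - 24 * ln a / (2 * x - 1) ^ 4)" for x
  have der: "(dPsi a has_real_derivative d2 x) (at x)" if "1/2 < x" for x
  proof -
    define w where "w = 2 * x - 1"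
    have w: "w \<noteq> 0"
      using that by (simp add: w_def)
    have "((\<lambda>w. 4 * ln a / w ^ 3) has_real_derivative - 12 * ln a / w ^ 4) (at w)"
      using w by (auto intro!: derivative_eq_intros simp: field_simps eval_nat_numeral)
    then have "((\<lambda>x. 4 * ln a / (2 * x - 1) ^ 3) has_real_derivative - 12 * ln a / w ^ 4 * 2) (at x)"
      unfolding w_def by (rule DERIV_chain2) (auto intro!: derivative_eq_intros)
    then have "((\<lambda>x. 4 * ln a / (2 * x - 1) ^ 3 * Psi a x) has_real_derivative
      - 12 * ln a / w ^ 4 * 2 * Psi a x + dPsi a x * (4 * ln a / (2 * x - 1) ^ 3)) (at x)"
      by (rule DERIV_mult) (rule Psi_has_derivative_gt[OF assms that])
    also have "- 12 * ln a / w ^ 4 * 2 * Psi a x + dPsi a x * (4 * ln a / (2 * x - 1) ^ 3) = d2 x"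
      using that w unfolding d2_def dPsi_def w_def[symmetric]
      by (simp add: divide_simps eval_nat_numeral) (simp add: algebra_simps)
    finally have "((\<lambda>x. 4 * ln a / (2 * x - 1) ^ 3 * Psi a x) has_real_derivative d2 x) (at x)" .
    moreover have "\<forall>\<^sub>F y in nhds x. dPsi a y = 4 * ln a / (2 * y - 1) ^ 3 * Psi a y"
      using eventually_nhds_in_open[of "{1/2<..}" x] that
      by (auto elim!: eventually_mono simp: dPsi_def)
    ultimately show ?thesis
      by (rule DERIV_eventually_eq)
  qed
  have d2: "\<bar>d2 x\<bar> \<le> a * (28 / ln a)" if "1/2 < x" for x
  proof -
    define s where "s = ln a / (2 * x - 1)\<^sup>2"
    have s: "0 < s"
      using that assms by (simp add: s_def)
    have "16 * (ln a)\<^sup>2 / w ^ 6 - 24 * ln a / w ^ 4 = 8 / ln a * (2 * (ln a / w\<^sup>2) ^ 3 - 3 * (ln a / w\<^sup>2)\<^sup>2)"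
      if "w \<noteq> 0" for w
      using that assms by (simp add: field_simps eval_nat_numeral)
    from this[of "2 * x - 1"] have "d2 x = a * exp (- s) * (8 / ln a * (2 * s ^ 3 - 3 * s\<^sup>2))"
      using that assms by (simp add: d2_def Psi_eq s_def)
    then have "d2 x = a * (8 / ln a) * (2 * (s ^ 3 * exp (- s)) - 3 * (s\<^sup>2 * exp (- s)))"
      by (simp add: algebra_simps)
    \<comment> \<open>The two terms enter with opposite signs, so the absolute value is at most the
      larger of 2 * 216/125 and 3 * 16/25, which is below 7/2. The constant 28 is 8 * 7/2.\<close>
    moreover have "\<bar>2 * (s ^ 3 * exp (- s)) - 3 * (s\<^sup>2 * exp (- s))\<bar> \<le> 7/2"
    proof -
      have "0 \<le> s ^ 3 * exp (- s)" "0 \<le> s\<^sup>2 * exp (- s)"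
        using s by auto
      moreover have "s ^ 3 * exp (- s) \<le> 216/125" "s\<^sup>2 * exp (- s) \<le> 16/25"
        using cube_mult_exp_minus_le[of s] square_mult_exp_minus_le[of s] s by auto
      ultimately show ?thesis
        by linarith
    qed
    ultimately have "\<bar>d2 x\<bar> \<le> a * (8 / ln a) * (7/2)"
      using assms by (simp only: abs_mult) (intro mult_mono, auto)
    then show ?thesis by (simp add: mult.commute)
  qed
  have bound: "\<bar>dPsi a x\<bar> \<le> a * (28 / ln a) * (x - 1/2)" if "1/2 < x" for x
  proof -
    define s where "s = ln a / (2 * x - 1)\<^sup>2"
    have s: "0 < s"
      using that assms by (simp add: s_def)
    have "dPsi a x = a * (8 / ln a) * (x - 1/2) * (s\<^sup>2 * exp (- s))"
    proof -
      have "4 * ln a / w ^ 3 = 8 / ln a * (w / 2) * (ln a / w\<^sup>2)\<^sup>2" if "w \<noteq> 0" for w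
        using that assms by (simp add: field_simps eval_nat_numeral)
      from this[of "2 * x - 1"] have "4 * ln a / (2 * x - 1) ^ 3 = 8 / ln a * (x - 1/2) * s\<^sup>2"
        using that by (simp add: s_def diff_divide_distrib)
      moreover have "dPsi a x = 4 * ln a / (2 * x - 1) ^ 3 * (a * exp (- s))"
        using that assms by (simp add: dPsi_eq s_def)
      ultimately show ?thesis
        by (simp only: mult_ac times_divide_eq_left times_divide_eq_right)
    qed
    also have "\<dots> \<le> a * (8 / ln a) * (x - 1/2) * (16/25)"
      using square_mult_exp_minus_le[of s] s that assms by (intro mult_left_mono) auto
    also have "\<dots> \<le> a * (28 / ln a) * (x - 1/2)"
      using that assms by (simp add: divide_simps)
    finally show ?thesis
      using that assms by (simp add: dPsi_def Psi_nonneg)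
  qed
  show ?thesis
    by (rule lipschitz_extend_by_zero[where c = "1/2", OF _ der d2 bound]) (simp add: dPsi_def)
qed

section \<open>Derivative bounds for \<open>Gam\<close>\<close>

lemma Gam_nonneg: "0 \<le> Gam x"
  by (simp add: Gam_def mult_nonpos_nonneg)

lemma Gam_has_derivative: "(Gam has_real_derivative dGam x) (at x)"
proof -
  consider "x < 0" | "x = 0" | "0 < x" by linarith
  then show ?thesis
  proof cases
    case 1
    have "((\<lambda>x. - x * exp (1 / x + 1)) has_real_derivative dGam x) (at x)"
      using 1 by (auto intro!: derivative_eq_intros simp: dGam_def field_simps)
    moreover have "\<forall>\<^sub>F y in nhds x. Gam y = - y * exp (1 / y + 1)"
      using eventually_nhds_in_open[of "{..<0}" x] 1
      by (auto elim!: eventually_mono simp: Gam_def)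
    ultimately show ?thesis
      by (rule DERIV_eventually_eq)
  next
    case 2
    \<comment> \<open>With \<open>v = - 1/y\<close> the exponential factor is
      \<open>exp 1 * exp (- v)\<close> and \<open>- y = y^2 * v\<close>, so the bound on
      \<open>v * exp (- v)\<close> makes \<open>Gam\<close> quadratically small at 0.\<close>
    have "\<bar>Gam y\<bar> \<le> exp 1 * (y - 0)\<^sup>2" for y
    proof (cases "y < 0")
      case True
      define v where "v = - (1 / y)"
      have v: "0 < v"
        using True by (simp add: v_def)
      have "exp (1 / y + 1) = exp 1 * exp (- v)"
        by (simp add: v_def flip: exp_add)
      then have "Gam y = exp 1 * y\<^sup>2 * (v * exp (- v))"
        using True by (simp add: Gam_def v_def power2_eq_square)
      also have "\<dots> \<le> exp 1 * y\<^sup>2 * (2/5)"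
        using mult_exp_minus_le[of v] v by (intro mult_left_mono) auto
      also have "\<dots> \<le> exp 1 * y\<^sup>2"
        by simp
      finally show ?thesis by (simp add: Gam_nonneg)
    qed (simp add: Gam_def)
    then have "(Gam has_real_derivative 0) (at 0)"
      by (rule has_real_derivative_zero_of_quadratic_bound)
    with 2 show ?thesis by (simp add: dGam_def)
  next
    case 3
    have "((\<lambda>_. 0) has_real_derivative dGam x) (at x)"
      using 3 by (simp add: dGam_def)
    moreover have "\<forall>\<^sub>F y in nhds x. Gam y = 0"
      using eventually_nhds_in_open[of "{0<..}" x] 3
      by (auto elim!: eventually_mono simp: Gam_def)
    ultimately show ?thesis
      by (rule DERIV_eventually_eq)
  qed
qed

lemma dGam_minus_eq:
  assumes "0 < x"
  shows "dGam (- x) = - (exp 1 * ((1 + 1 / x) * exp (- (1 / x))))"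
proof -
  have "exp (1 / - x + 1) = exp 1 * exp (- (1 / x))"
    by (simp flip: exp_add)
  with assms show ?thesis
    unfolding dGam_def by (simp add: algebra_simps)
qed

lemma dGam_bound: "\<bar>dGam x\<bar> \<le> exp 1"
proof (cases "x < 0")
  case True
  define v where "v = - (1 / x)"
  have v: "0 < v"
    using True by (simp add: v_def)
  have "\<bar>dGam x\<bar> = exp 1 * ((1 + v) * exp (- v))"
    using dGam_minus_eq[of "- x"] True v by (simp add: v_def)
  also have "\<dots> \<le> exp 1 * 1"
    using exp_ge_add_one_self[of v] by (intro mult_left_mono) (auto simp: exp_minus field_simps)
  finally show ?thesis by simp
qed (simp add: dGam_def)

text \<open>Reflecting the argument moves the half line where \<open>dGam\<close> vanishes to the
  left of 0, as the extension-by-zero lemma requires. With \<open>v = 1 / x\<close> the derivative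
  of the reflected function is, up to sign, \<open>exp 1 * v ^ 3 * exp (- v)\<close>, at most 2.72 *
  216/125 < 5.\<close>

lemma dGam_lipschitz: "\<bar>dGam x - dGam y\<bar> \<le> 5 * \<bar>x - y\<bar>"
proof -
  have cube: "exp 1 * (v ^ 3 * exp (- v)) \<le> 5" if "0 < v" for v :: real
  proof -
    have "exp 1 * (v ^ 3 * exp (- v)) \<le> (272/100) * (216/125)"
      using e_less_272 cube_mult_exp_minus_le[of v] that by (intro mult_mono) auto
    then show ?thesis by simp
  qed
  have "\<bar>dGam (- u) - dGam (- v)\<bar> \<le> 5 * \<bar>u - v\<bar>" for u v
  proof (rule lipschitz_extend_by_zero[where c = 0 and f = "\<lambda>x. dGam (- x)"
        and f' = "\<lambda>x. - (exp 1 * ((1 / x) ^ 3 * exp (- (1 / x))))"])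
    fix x :: real
    assume x: "0 < x"
    have "((\<lambda>x. - (exp 1 * ((1 + 1 / x) * exp (- (1 / x))))) has_real_derivative
      - (exp 1 * ((1 / x) ^ 3 * exp (- (1 / x))))) (at x)"
      using x by (auto intro!: derivative_eq_intros simp: field_simps power3_eq_cube)
    moreover have "\<forall>\<^sub>F y in nhds x. dGam (- y) = - (exp 1 * ((1 + 1 / y) * exp (- (1 / y))))"
      using eventually_nhds_in_open[of "{0<..}" x] x
      by (auto elim!: eventually_mono simp: dGam_minus_eq)
    ultimately show "((\<lambda>x. dGam (- x)) has_real_derivative
      - (exp 1 * ((1 / x) ^ 3 * exp (- (1 / x))))) (at x)"
      by (rule DERIV_eventually_eq)
    show "\<bar>- (exp 1 * ((1 / x) ^ 3 * exp (- (1 / x))))\<bar> \<le> 5"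
      using cube[of "1 / x"] x by simp
    define v where "v = 1 / x"
    have v: "0 < v" and x_eq: "x = 1 / v"
      using x by (auto simp: v_def)
    have "\<bar>dGam (- x)\<bar> = exp 1 * ((1 + v) * exp (- v))"
      using x v by (simp add: dGam_minus_eq abs_mult v_def)
    \<comment> \<open>Since \<open>v * x = 1\<close>, a factor \<open>x\<close> can be extracted at
      the price of one more power of \<open>v\<close>, which yields the linear bound at 0.\<close>
    also have "\<dots> = exp 1 * (v * exp (- v) + v\<^sup>2 * exp (- v)) * x"
      using v unfolding x_eq by (simp add: divide_simps) (simp add: algebra_simps power2_eq_square)
    also have "\<dots> \<le> (272/100) * (2/5 + 16/25) * x"
      using e_less_272 mult_exp_minus_le[of v] square_mult_exp_minus_le[of v] v x
      by (intro mult_right_mono mult_mono add_mono) auto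
    also have "\<dots> \<le> 5 * x"
      using x by simp
    finally show "\<bar>dGam (- x)\<bar> \<le> 5 * (x - 0)"
      by simp
  qed (simp add: dGam_def)
  from this[of "- x" "- y"] show ?thesis
    by (simp add: abs_minus_commute)
qed

section \<open>The Gaussian integral and \<open>Phi\<close>\<close>

lemma gaussian_has_integral_UNIV:
  "((\<lambda>t::real. exp (- (t\<^sup>2 / 2))) has_integral sqrt (2 * pi)) UNIV"
proof -
  have "(std_normal_density has_integral 1) UNIV"
    using has_integral_integral_lborel[OF integrable_normal_density[of 1 0]]
      integral_normal_density[of 1 0] by simp
  then have "((\<lambda>t. sqrt (2 * pi) * std_normal_density t) has_integral sqrt (2 * pi) * 1) UNIV"
    by (rule has_integral_mult_right)
  then show ?thesis
    by (simp add: std_normal_density_def)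
qed

lemma gaussian_integrable_on:
  assumes "S \<in> sets borel"
  shows "(\<lambda>t::real. exp (- (t\<^sup>2 / 2))) integrable_on S"
proof -
  have "integrable lborel (\<lambda>t. sqrt (2 * pi) * std_normal_density t)"
    by (intro integrable_mult_right integrable_normal_density) simp
  then have "integrable lborel (\<lambda>t::real. exp (- (t\<^sup>2 / 2)))"
    by (simp add: std_normal_density_def)
  then have "set_integrable lborel S (\<lambda>t::real. exp (- (t\<^sup>2 / 2)))"
    unfolding set_integrable_def using assms by (intro integrable_mult_indicator) auto
  then show ?thesis
    by (rule set_borel_integral_eq_integral)
qed

text \<open>The half-infinite integral is split at \<open>x - 1\<close>. Near \<open>x\<close> the
  left piece is constant, and the fundamental theorem of calculus applies to the right piece on a
  compact interval.\<close>

lemma Phi_has_derivative: "(Phi has_real_derivative dPhi x) (at x)"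
proof -
  let ?g = "\<lambda>t::real. exp (- (t\<^sup>2 / 2))"
  have cont: "continuous_on A ?g" for A
    by (rule continuous_intros | simp)+
  have "((\<lambda>y. integral {x - 1..y} ?g) has_real_derivative ?g x) (at x within {x - 1..x + 1})"
    by (rule integral_has_real_derivative[OF cont]) simp
  then have "((\<lambda>y. integral {x - 1..y} ?g) has_real_derivative ?g x) (at x)"
    by (simp add: at_within_Icc_at)
  then have "((\<lambda>y. sqrt (exp 1) * (integral {..x - 1} ?g + integral {x - 1..y} ?g)) has_real_derivative dPhi x) (at x)"
    by (auto intro!: derivative_eq_intros simp: dPhi_def)
  moreover have "\<forall>\<^sub>F y in nhds x. Phi y = sqrt (exp 1) * (integral {..x - 1} ?g + integral {x - 1..y} ?g)"
    using eventually_nhds_in_open[of "{x - 1<..}" x]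
  proof (rule eventually_mono)
    fix y assume "y \<in> {x - 1<..}"
    then have "{..y} = {..x - 1} \<union> {x - 1..y}" "{..x - 1} \<inter> {x - 1..y} = {x - 1}"
      by auto
    then show "Phi y = sqrt (exp 1) * (integral {..x - 1} ?g + integral {x - 1..y} ?g)"
      using integral_Un[of ?g "{..x - 1}" "{x - 1..y}"] gaussian_integrable_on
      by (simp add: Phi_def)
  qed auto
  ultimately show ?thesis
    by (rule DERIV_eventually_eq)
qed

lemma Phi_nonneg: "0 \<le> Phi x"
  unfolding Phi_def by (intro mult_nonneg_nonneg integral_nonneg gaussian_integrable_on) auto

lemma Phi_le: "Phi x \<le> sqrt (2 * pi * exp 1)"
proof -
  have "integral {..x} (\<lambda>t. exp (- (t\<^sup>2 / 2))) \<le> integral UNIV (\<lambda>t. exp (- (t\<^sup>2 / 2)))"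
    by (intro integral_subset_le gaussian_integrable_on) auto
  also have "\<dots> = sqrt (2 * pi)"
    by (rule integral_unique[OF gaussian_has_integral_UNIV])
  finally show ?thesis
    unfolding Phi_def by (simp add: real_sqrt_mult)
qed

lemma dPhi_bound: "\<bar>dPhi x\<bar> \<le> sqrt (exp 1)"
  by (simp add: dPhi_def abs_mult)

lemma dPhi_lipschitz: "\<bar>dPhi x - dPhi y\<bar> \<le> sqrt (exp 1) * \<bar>x - y\<bar>"
proof -
  have "norm (dPhi x - dPhi y) \<le> sqrt (exp 1) * norm (x - y)"
  proof (rule field_differentiable_bound)
    fix z :: real
    show "(dPhi has_field_derivative - (sqrt (exp 1) * (z * exp (- (z\<^sup>2 / 2))))) (at z within UNIV)"
      unfolding dPhi_def[abs_def] by (auto intro!: derivative_eq_intros)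
    \<comment> \<open>Expanding \<open>(\<bar>z\<bar> - 1)^2 \<ge> 0\<close> gives this, with room
      to spare; comparison with the exponential then bounds the derivative of the Gaussian.\<close>
    have "\<bar>z\<bar> \<le> 1 + z\<^sup>2 / 2"
      using zero_le_power2[of "\<bar>z\<bar> - 1"] by (simp add: power2_diff)
    also have "\<dots> \<le> exp (z\<^sup>2 / 2)"
      by (rule exp_ge_add_one_self)
    finally have "\<bar>z\<bar> * exp (- (z\<^sup>2 / 2)) \<le> 1"
      by (simp add: exp_minus field_simps)
    then show "norm (- (sqrt (exp 1) * (z * exp (- (z\<^sup>2 / 2))))) \<le> sqrt (exp 1)"
      by (simp add: abs_mult)
  qed auto
  then show ?thesis by simp
qed

section \<open>Uniform estimates for the factors of a summand\<close>

text \<open>\<open>link a j\<close> is the factor that the summand of \<open>F\<close> with index \<open>i\<close> applies to coordinate \<open>i - j\<close>.\<close>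

definition link :: "real \<Rightarrow> nat \<Rightarrow> real \<Rightarrow> real" where
  "link a j = (if j = 0 then Phi else Psi a)"

definition dlink :: "real \<Rightarrow> nat \<Rightarrow> real \<Rightarrow> real" where
  "dlink a j = (if j = 0 then dPhi else dPsi a)"

definition link_sup :: "real \<Rightarrow> nat \<Rightarrow> real" where
  "link_sup a j = (if j = 0 then sqrt (2 * pi * exp 1) else a)"

lemma link_has_derivative:
  "1 < a \<Longrightarrow> (link a j has_real_derivative dlink a j x) (at x)"
  by (simp add: link_def dlink_def Phi_has_derivative Psi_has_derivative)

lemma link_nonneg: "0 \<le> link a j x"
  by (simp add: link_def Phi_nonneg Psi_nonneg)

lemma link_le: "1 < a \<Longrightarrow> link a j x \<le> link_sup a j"
  by (simp add: link_def link_sup_def Phi_le Psi_le)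

lemma link_sup_pos: "1 < a \<Longrightarrow> 0 < link_sup a j"
  by (simp add: link_sup_def)

text \<open>The upper bound on \<open>a\<close> enters here. It gives \<open>r \<ge> 1\<close>, so
  that bounds free of \<open>ln a\<close>, such as those on \<open>Phi\<close>, can be absorbed into
  multiples of \<open>r\<close> or \<open>r^2\<close>.\<close>

lemma one_le_inverse_sqrt_ln:
  assumes "1 < a" "a \<le> exp 1"
  shows "1 \<le> 1 / sqrt (ln a)"
proof -
  have "ln a \<le> ln (exp 1)"
    using assms by (subst ln_le_cancel_iff) auto
  then show ?thesis
    using assms by (simp add: divide_simps)
qed

lemma sqrt_exp_le: "sqrt (exp 1) \<le> sqrt (2 * pi * exp 1)"
  using pi_gt3 by simp

context
  fixes a r :: real
  assumes a: "1 < a" "a \<le> exp 1"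
  defines "r \<equiv> 1 / sqrt (ln a)"
begin

lemma scale_ge_one: "1 \<le> r"
  unfolding r_def using a by (rule one_le_inverse_sqrt_ln)

lemma scale_square: "r\<^sup>2 = 1 / ln a"
  using a by (simp add: r_def power_divide)

lemma dlink_bound: "\<bar>dlink a j x\<bar> \<le> link_sup a j * (2 * r)"
proof (cases "j = 0")
  case True
  have "\<bar>dPhi x\<bar> \<le> sqrt (2 * pi * exp 1) * 1"
    using order_trans[OF dPhi_bound sqrt_exp_le] by simp
  also have "\<dots> \<le> sqrt (2 * pi * exp 1) * (2 * r)"
    using scale_ge_one by (intro mult_left_mono) auto
  finally show ?thesis
    using True by (simp add: dlink_def link_sup_def)
next
  case False
  then show ?thesis
    using dPsi_bound[OF a(1), of x] by (simp add: dlink_def link_sup_def r_def)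
qed

lemma link_lipschitz: "\<bar>link a j x - link a j y\<bar> \<le> link_sup a j * (2 * r * \<bar>x - y\<bar>)"
proof -
  have "norm (link a j x - link a j y) \<le> link_sup a j * (2 * r) * norm (x - y)"
    by (rule field_differentiable_bound[where S = UNIV and f' = "dlink a j"])
      (use a link_has_derivative dlink_bound in auto)
  then show ?thesis
    by (simp add: mult.assoc)
qed

text \<open>The constant 28 r^2 is written as \<open>2 * r\<close> times \<open>14 * r\<close>: the
  first part belongs to the supremum bound on \<open>dlink\<close>, and the second is the Lipschitz
  constant relative to that bound, the shape \<open>B m * d m\<close> expected by the product
  estimate below.\<close>

lemma dlink_lipschitz:
  "\<bar>dlink a j x - dlink a j y\<bar> \<le> link_sup a j * (2 * r) * (14 * r * \<bar>x - y\<bar>)"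
proof (cases "j = 0")
  case True
  have "\<bar>dPhi x - dPhi y\<bar> \<le> sqrt (2 * pi * exp 1) * 1 * (1 * \<bar>x - y\<bar>)"
    using dPhi_lipschitz[of x y] mult_right_mono[OF sqrt_exp_le, of "\<bar>x - y\<bar>"] by simp
  also have "\<dots> \<le> sqrt (2 * pi * exp 1) * (2 * r) * (14 * r * \<bar>x - y\<bar>)"
    using scale_ge_one by (intro mult_mono) auto
  finally show ?thesis
    using True by (simp add: dlink_def link_sup_def)
next
  case False
  have "28 / ln a = (2 * r) * (14 * r)"
    using scale_square by (simp add: power2_eq_square)
  then show ?thesis
    using False dPsi_lipschitz[OF a(1), of x y] by (simp add: dlink_def link_sup_def mult.assoc)
qed

end

section \<open>Lipschitz estimate for products\<close>

text \<open>Factors are exchanged one at a time. Because the Lipschitz bounds are relative to the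
  suprema \<open>B\<close>, the full product of suprema factors out and the relative constants
  simply add.\<close>

lemma prod_diff_bound:
  fixes f g B d :: "'a \<Rightarrow> real"
  assumes "finite I"
    and "\<And>m. m \<in> I \<Longrightarrow> \<bar>f m\<bar> \<le> B m"
    and "\<And>m. m \<in> I \<Longrightarrow> \<bar>g m\<bar> \<le> B m"
    and "\<And>m. m \<in> I \<Longrightarrow> \<bar>f m - g m\<bar> \<le> B m * d m"
  shows "\<bar>prod f I - prod g I\<bar> \<le> prod B I * sum d I"
  using assms
proof (induction I rule: finite_induct)
  case (insert i I)
  have B: "0 \<le> B m" if "m \<in> insert i I" for m
    using insert.prems(1)[OF that] by linarith
  have "\<bar>prod f (insert i I) - prod g (insert i I)\<bar>
      = \<bar>(f i - g i) * prod f I + g i * (prod f I - prod g I)\<bar>"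
    using insert.hyps by (simp add: algebra_simps)
  also have "\<dots> \<le> \<bar>f i - g i\<bar> * prod (\<lambda>m. \<bar>f m\<bar>) I + \<bar>g i\<bar> * \<bar>prod f I - prod g I\<bar>"
    by (metis abs_mult abs_prod abs_triangle_ineq)
  also have "\<dots> \<le> (B i * d i) * prod B I + B i * (prod B I * sum d I)"
  proof -
    have "\<bar>f i - g i\<bar> \<le> B i * d i" "\<bar>g i\<bar> \<le> B i" "\<bar>prod f I - prod g I\<bar> \<le> prod B I * sum d I"
      using insert by auto
    moreover have "prod (\<lambda>m. \<bar>f m\<bar>) I \<le> prod B I"
      using insert.prems(1) by (intro prod_mono) auto
    ultimately show ?thesis
      using B by (intro add_mono mult_mono' prod_nonneg) auto
  qed
  also have "\<dots> = prod B (insert i I) * sum d (insert i I)"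
    using insert.hyps by (simp add: algebra_simps)
  finally show ?case .
qed simp

section \<open>Coordinate directions and sums along a shifted window\<close>

text \<open>
  The gradient of \<open>coord\<close>; it vanishes on the conventional coordinates \<open>k \<le> 0\<close>, so windows that
  reach below index 1 need no separate treatment.
\<close>

definition coord_dir :: "(nat \<Rightarrow> 'n::finite) \<Rightarrow> int \<Rightarrow> real ^ 'n" where
  "coord_dir e k = (if k \<le> 0 then 0 else axis (e (nat k)) 1)"

lemma coord_diff: "coord e x k - coord e y k = (x - y) \<bullet> coord_dir e k"
  by (simp add: coord_def coord_dir_def inner_axis)

text \<open>\<open>coord\<close> is affine in \<open>x\<close>, with constant part
  \<open>coord e 0 k\<close> equal to 1 on the conventional coordinates and 0 on the others.\<close>

lemma coord_has_derivative: "((\<lambda>x. coord e x k) has_derivative (\<lambda>h. h \<bullet> coord_dir e k)) (at x)"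
proof -
  have "coord e x k = coord e 0 k + x \<bullet> coord_dir e k" for x
    using coord_diff[of e x k 0] by simp
  then have eq: "(\<lambda>x. coord e x k) = (\<lambda>x. coord e 0 k + x \<bullet> coord_dir e k)"
    by (rule ext)
  have "((\<lambda>x. coord e 0 k + x \<bullet> coord_dir e k) has_derivative (\<lambda>h. h \<bullet> coord_dir e k)) (at x)"
    by (auto intro!: derivative_eq_intros)
  then show ?thesis
    unfolding eq .
qed

context
  fixes e :: "nat \<Rightarrow> 'n::finite" and T :: nat
  assumes bij: "bij_betw e {1..T} UNIV"
begin

text \<open>If \<open>c\<close> is the coordinate numbered \<open>k\<close>, only
  \<open>i = k + m\<close> can contribute. Indices \<open>i \<le> m\<close> land on conventional
  coordinates, where the direction is zero.\<close>

lemma sum_coord_dir_component_le: "(\<Sum>i = 1..T. \<bar>coord_dir e (int i - int m) $ c\<bar>) \<le> 1"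
proof -
  obtain k where k: "k \<in> {1..T}" "c = e k"
    using bij by (metis bij_betw_imp_surj_on imageE UNIV_I)
  have "\<bar>coord_dir e (int i - int m) $ c\<bar> \<le> (if i = k + m then 1 else 0)" if "i \<in> {1..T}" for i
  proof (cases "m < i \<and> e (i - m) = e k")
    case True
    then have "i - m = k"
      using bij k that by (intro inj_onD[of e "{1..T}" "i - m" k]) (auto simp: bij_betw_def)
    with True have "i = k + m"
      by auto
    then show ?thesis
      by (simp add: coord_dir_def axis_def)
  next
    case False
    have "nat (int i - int m) = i - m"
      by simp
    with False show ?thesis
      by (auto simp: coord_dir_def axis_def k)
  qed
  then have "(\<Sum>i = 1..T. \<bar>coord_dir e (int i - int m) $ c\<bar>) \<le> (\<Sum>i = 1..T. if i = k + m then 1 else 0)"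
    by (rule sum_mono)
  also have "\<dots> \<le> 1"
    by simp
  finally show ?thesis .
qed

lemma shifted_sum_component_le:
  assumes "\<And>i. \<bar>v i\<bar> \<le> M"
  shows "\<bar>(\<Sum>i = 1..T. v i *\<^sub>R coord_dir e (int i - int m)) $ c\<bar> \<le> M"
proof -
  have M: "0 \<le> M"
    using assms[of 0] by linarith
  have "\<bar>(\<Sum>i = 1..T. v i *\<^sub>R coord_dir e (int i - int m)) $ c\<bar>
      \<le> (\<Sum>i = 1..T. \<bar>v i\<bar> * \<bar>coord_dir e (int i - int m) $ c\<bar>)"
    using sum_abs[of "\<lambda>i. v i * coord_dir e (int i - int m) $ c" "{1..T}"]
    by (simp add: abs_mult)
  also have "\<dots> \<le> (\<Sum>i = 1..T. M * \<bar>coord_dir e (int i - int m) $ c\<bar>)"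
    by (intro sum_mono mult_right_mono assms) simp
  also have "\<dots> \<le> M * 1"
    unfolding sum_distrib_left[symmetric]
    by (intro mult_left_mono sum_coord_dir_component_le M)
  finally show ?thesis
    by simp
qed

text \<open>For fixed \<open>m\<close> the inner products are either zero or pairwise distinct
  coordinates of \<open>z\<close>, so their squares sum to at most the square of the norm.\<close>

lemma L2_set_shifted_coord_le:
  "L2_set (\<lambda>i. z \<bullet> coord_dir e (int i - int m)) {1..T} \<le> norm z"
proof -
  have inj: "inj_on (\<lambda>i. e (i - m)) {m<..T}"
  proof (rule inj_onI)
    fix i i' assume "i \<in> {m<..T}" "i' \<in> {m<..T}" "e (i - m) = e (i' - m)"
    moreover from this have "i - m = i' - m"
      using bij by (auto simp: bij_betw_def dest!: inj_onD)
    ultimately show "i = i'"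
      by auto
  qed
  have "(\<Sum>i = 1..T. (z \<bullet> coord_dir e (int i - int m))\<^sup>2) = (\<Sum>i \<in> {m<..T}. (z $ e (i - m))\<^sup>2)"
    by (rule sum.mono_neutral_cong_right)
      (auto simp: coord_dir_def inner_axis nat_diff_distrib)
  also have "\<dots> = (\<Sum>c \<in> (\<lambda>i. e (i - m)) ` {m<..T}. (z $ c)\<^sup>2)"
    using inj by (simp add: sum.reindex)
  also have "\<dots> \<le> (\<Sum>c \<in> UNIV. (z $ c)\<^sup>2)"
    by (intro sum_mono2) auto
  finally show ?thesis
    by (simp add: L2_set_def norm_vec_def)
qed

text \<open>Dual to the preceding lemma: the map from \<open>v\<close> to the sum is the adjoint of
  a contraction. Concretely, the sum \<open>z\<close> is paired with itself, Cauchy-Schwarz is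
  applied, and one factor \<open>norm z\<close> is cancelled.\<close>

lemma norm_sum_shifted_coord_dir_le:
  "norm (\<Sum>i = 1..T. v i *\<^sub>R coord_dir e (int i - int m)) \<le> L2_set v {1..T}"
proof -
  define z where "z = (\<Sum>i = 1..T. v i *\<^sub>R coord_dir e (int i - int m))"
  have "(norm z)\<^sup>2 = z \<bullet> z"
    by (simp add: dot_square_norm)
  also have "\<dots> = (\<Sum>i = 1..T. v i * (z \<bullet> coord_dir e (int i - int m)))"
    by (subst (2) z_def) (simp add: inner_sum_right)
  also have "\<dots> \<le> (\<Sum>i = 1..T. \<bar>v i\<bar> * \<bar>z \<bullet> coord_dir e (int i - int m)\<bar>)"
    by (intro sum_mono) (metis abs_ge_self abs_mult)
  also have "\<dots> \<le> L2_set v {1..T} * L2_set (\<lambda>i. z \<bullet> coord_dir e (int i - int m)) {1..T}"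
    by (rule L2_set_mult_ineq)
  also have "\<dots> \<le> L2_set v {1..T} * norm z"
    by (intro mult_left_mono L2_set_shifted_coord_le L2_set_nonneg)
  finally have "norm z * norm z \<le> L2_set v {1..T} * norm z"
    by (simp add: power2_eq_square)
  then have "norm z \<le> L2_set v {1..T}"
    by (cases "norm z = 0") (auto simp: L2_set_nonneg)
  then show ?thesis
    by (simp add: z_def)
qed

end

section \<open>The gradient of \<open>F\<close> and the function gap\<close>

definition partial_term :: "(nat \<Rightarrow> 'n::finite) \<Rightarrow> nat \<Rightarrow> real \<Rightarrow> real ^ 'n \<Rightarrow> nat \<Rightarrow> nat \<Rightarrow> real" where
  "partial_term e K a x i j =
     dlink a j (coord e x (int i - int j))
     * (\<Prod>m \<in> {..K} - {j}. link a m (coord e x (int i - int m)))"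

text \<open>The position \<open>j\<close> is the outer summation index, so that each inner sum is a
  family with one fixed shift, as in the estimates on shifted sums.\<close>

definition gradF :: "(nat \<Rightarrow> 'n::finite) \<Rightarrow> nat \<Rightarrow> nat \<Rightarrow> real \<Rightarrow> real ^ 'n \<Rightarrow> real ^ 'n" where
  "gradF e T K a x =
     (\<Sum>i = 1..T. dGam (coord e x (int i)) *\<^sub>R coord_dir e (int i))
     - (\<Sum>j\<le>K. \<Sum>i = 1..T. partial_term e K a x i j *\<^sub>R coord_dir e (int i - int j))"

lemma prod_Psi_mult_Phi:
  "(\<Prod>j = 1..K. Psi a (coord e x (int i - int j))) * Phi (coord e x (int i))
     = (\<Prod>m\<le>K. link a m (coord e x (int i - int m)))"
proof -
  have "{..K} = insert 0 {1..K}"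
    by auto
  then have "(\<Prod>m\<le>K. link a m (coord e x (int i - int m)))
      = Phi (coord e x (int i)) * (\<Prod>j = 1..K. link a j (coord e x (int i - int j)))"
    by (simp add: link_def)
  also have "(\<Prod>j = 1..K. link a j (coord e x (int i - int j))) = (\<Prod>j = 1..K. Psi a (coord e x (int i - int j)))"
    by (rule prod.cong) (auto simp: link_def)
  finally show ?thesis
    by simp
qed

lemma F_eq:
  "F e T K a x = (\<Sum>i = 1..T. Gam (coord e x (int i)))
     - (\<Sum>i = 1..T. \<Prod>m\<le>K. link a m (coord e x (int i - int m)))"
  unfolding F_def prod_Psi_mult_Phi by simp

lemma prod_link_sup: "(\<Prod>m\<le>K. link_sup a m) = Delta0 K a"
proof -
  have "{..K} = insert 0 {1..K}"
    by auto
  then have "(\<Prod>m\<le>K. link_sup a m) = sqrt (2 * pi * exp 1) * (\<Prod>m = 1..K. link_sup a m)"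
    by (simp add: link_sup_def)
  also have "(\<Prod>m = 1..K. link_sup a m) = (\<Prod>m = 1..K. a)"
    by (rule prod.cong) (auto simp: link_sup_def)
  finally show ?thesis
    by (simp add: Delta0_def)
qed

lemma prod_link_nonneg: "0 \<le> (\<Prod>m\<le>K. link a m (y m))"
  by (intro prod_nonneg) (simp add: link_nonneg)

lemma prod_link_le:
  assumes "1 < a"
  shows "(\<Prod>m\<le>K. link a m (y m)) \<le> Delta0 K a"
  unfolding prod_link_sup[symmetric] using assms
  by (intro prod_mono) (simp add: link_nonneg link_le)

lemma F_ge:
  assumes "1 < a"
  shows "- (Delta0 K a * real T) \<le> F e T K a x"
proof -
  have "(\<Sum>i = 1..T. \<Prod>m\<le>K. link a m (coord e x (int i - int m))) \<le> (\<Sum>i = 1..T. Delta0 K a)"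
    using assms by (intro sum_mono prod_link_le)
  moreover have "0 \<le> (\<Sum>i = 1..T. Gam (coord e x (int i)))"
    by (intro sum_nonneg Gam_nonneg)
  ultimately show ?thesis
    unfolding F_eq by (simp add: mult.commute)
qed

text \<open>At the origin every penalty \<open>Gam\<close> vanishes and the products are
  nonnegative. With the lower bound \<open>F_ge\<close> this controls the gap between the value at 0
  and the infimum.\<close>

lemma F_zero_le: "F e T K a 0 \<le> 0"
proof -
  have "(\<Sum>i = 1..T. Gam (coord e 0 (int i))) = 0"
    by (intro sum.neutral) (simp add: coord_def Gam_def)
  moreover have "0 \<le> (\<Sum>i = 1..T. \<Prod>m\<le>K. link a m (coord e 0 (int i - int m)))"
    by (intro sum_nonneg prod_link_nonneg)
  ultimately show ?thesis
    unfolding F_eq by simp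
qed

lemma F_gderiv:
  assumes "1 < a"
  shows "GDERIV (F e T K a) x :> gradF e T K a x"
proof -
  have link: "((\<lambda>x. link a m (coord e x k)) has_derivative
      (\<lambda>h. dlink a m (coord e x k) * (h \<bullet> coord_dir e k))) (at x)" for m k
    using has_derivative_compose[OF coord_has_derivative
        link_has_derivative[OF assms, unfolded has_field_derivative_def]] .
  have gam: "((\<lambda>x. Gam (coord e x k)) has_derivative
      (\<lambda>h. dGam (coord e x k) * (h \<bullet> coord_dir e k))) (at x)" for k
    using has_derivative_compose[OF coord_has_derivative
        Gam_has_derivative[unfolded has_field_derivative_def]] .
  have "((\<lambda>x. F e T K a x) has_derivative
    (\<lambda>h. (\<Sum>i = 1..T. dGam (coord e x (int i)) * (h \<bullet> coord_dir e (int i)))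
      - (\<Sum>i = 1..T. \<Sum>j\<le>K. dlink a j (coord e x (int i - int j)) * (h \<bullet> coord_dir e (int i - int j))
          * (\<Prod>m\<in>{..K} - {j}. link a m (coord e x (int i - int m)))))) (at x)"
    unfolding F_eq
    by (intro has_derivative_diff has_derivative_sum has_derivative_prod gam link)
  \<comment> \<open>The product rule leaves the sum over \<open>i\<close> outside; exchanging it
    with the sum over \<open>j\<close> matches the order used in \<open>gradF\<close>.\<close>
  also have "(\<lambda>h. (\<Sum>i = 1..T. dGam (coord e x (int i)) * (h \<bullet> coord_dir e (int i)))
      - (\<Sum>i = 1..T. \<Sum>j\<le>K. dlink a j (coord e x (int i - int j)) * (h \<bullet> coord_dir e (int i - int j))
          * (\<Prod>m\<in>{..K} - {j}. link a m (coord e x (int i - int m)))))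
      = (\<lambda>h. h \<bullet> gradF e T K a x)"
    unfolding gradF_def inner_diff_right inner_sum_right inner_scaleR_right partial_term_def
      sum.swap[of _ "{..K}"]
    by (intro ext arg_cong2[where f = minus] sum.cong refl) (simp add: mult_ac)
  finally show ?thesis
    by (simp add: gderiv_def)
qed

text \<open>Serves to evaluate the definite description in \<open>gradient\<close>. The two linear
  forms agree, in particular on the vector \<open>D - D'\<close>.\<close>

lemma gderiv_unique:
  assumes "GDERIV f x :> D" "GDERIV f x :> D'"
  shows "D = D'"
proof -
  have "(\<lambda>h. h \<bullet> D) = (\<lambda>h. h \<bullet> D')"
    using assms unfolding gderiv_def by (rule has_derivative_unique)
  then have "(D - D') \<bullet> (D - D') = 0"
    unfolding inner_diff_right by (metis diff_self)
  then show ?thesis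
    by simp
qed

lemma gradient_F:
  assumes "1 < a"
  shows "gradient (F e T K a) = gradF e T K a"
  unfolding gradient_def
  by (intro ext the_equality F_gderiv[OF assms]) (rule gderiv_unique[OF _ F_gderiv[OF assms]])

section \<open>Bounds on the partial terms and comparison of constants\<close>

lemma prod_remove_link_sup:
  assumes "j \<le> K"
  shows "link_sup a j * (\<Prod>m\<in>{..K} - {j}. link_sup a m) = Delta0 K a"
  using assms by (simp add: prod.remove[of "{..K}" j] flip: prod_link_sup)

lemma sqrt_exp_one: "sqrt (exp 1) = exp (1/2)"
  by (rule real_sqrt_unique) (simp_all add: power2_eq_square flip: exp_add)

context
  fixes a r :: real and K :: nat
  assumes a: "1 < a" "a \<le> exp 1"
  defines "r \<equiv> 1 / sqrt (ln a)"
begin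

lemma partial_term_bound:
  assumes "j \<le> K"
  shows "\<bar>partial_term e K a x i j\<bar> \<le> 2 * r * Delta0 K a"
proof -
  have "\<bar>partial_term e K a x i j\<bar>
      \<le> link_sup a j * (2 * r) * (\<Prod>m\<in>{..K} - {j}. link_sup a m)"
    unfolding partial_term_def abs_mult abs_prod r_def
    using a link_sup_pos[of a] one_le_inverse_sqrt_ln[of a]
    by (intro mult_mono dlink_bound prod_mono prod_nonneg)
      (auto simp: link_nonneg link_le less_imp_le)
  also have "\<dots> = 2 * r * Delta0 K a"
    using prod_remove_link_sup[OF assms] by (simp add: mult_ac)
  finally show ?thesis .
qed

lemma partial_term_diff_bound:
  assumes "j \<le> K"
  shows "\<bar>partial_term e K a x i j - partial_term e K a y i j\<bar>
    \<le> 2 * r * Delta0 K a * (14 * r * \<bar>(x - y) \<bullet> coord_dir e (int i - int j)\<bar>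
      + (\<Sum>m\<in>{..K} - {j}. 2 * r * \<bar>(x - y) \<bullet> coord_dir e (int i - int m)\<bar>))"
proof -
  let ?c = "\<lambda>x m. coord e x (int i - int m)"
  \<comment> \<open>The differentiated factor is put back at position \<open>j\<close>. This gives
    one product over \<open>{..K}\<close>, with relative Lipschitz constant \<open>14 * r\<close> at
    \<open>j\<close> and \<open>2 * r\<close> elsewhere.\<close>
  let ?f = "\<lambda>x m. if m = j then dlink a j (?c x j) else link a m (?c x m)"
  let ?B = "\<lambda>m. if m = j then link_sup a j * (2 * r) else link_sup a m"
  let ?d = "\<lambda>m. (if m = j then 14 else 2) * r * \<bar>(x - y) \<bullet> coord_dir e (int i - int m)\<bar>"
  have split: "prod (\<lambda>m. if m = j then u else w m) {..K} = u * prod w ({..K} - {j})" for u :: real and w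
    using assms by (simp add: prod.remove[of "{..K}" j])
  have bound: "\<bar>?f x m\<bar> \<le> ?B m" for x m
    using a dlink_bound[OF a, of j] link_le[OF a(1)] by (simp add: r_def link_nonneg)
  have "\<bar>prod (?f x) {..K} - prod (?f y) {..K}\<bar> \<le> prod ?B {..K} * sum ?d {..K}"
  proof (rule prod_diff_bound[OF _ bound bound])
    fix m
    show "\<bar>?f x m - ?f y m\<bar> \<le> ?B m * ?d m"
      using dlink_lipschitz[OF a, of j "?c x j" "?c y j"] link_lipschitz[OF a, of m "?c x m" "?c y m"]
      by (simp add: r_def coord_diff)
  qed simp
  moreover have "prod ?B {..K} = 2 * r * Delta0 K a"
    unfolding split using prod_remove_link_sup[OF assms] by (simp add: mult_ac)
  moreover have "sum ?d {..K} = 14 * r * \<bar>(x - y) \<bullet> coord_dir e (int i - int j)\<bar>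
      + (\<Sum>m\<in>{..K} - {j}. 2 * r * \<bar>(x - y) \<bullet> coord_dir e (int i - int m)\<bar>)"
    using assms by (simp add: sum.remove[of "{..K}" j])
  ultimately show ?thesis
    unfolding split partial_term_def by simp
qed

lemma Delta0_pos: "0 < Delta0 K a"
  using a by (simp add: Delta0_def)

text \<open>The number 272/100 is chosen to dominate \<open>exp 1\<close>. It lets
  \<open>Delta0\<close> absorb the contributions of \<open>Gam\<close>, namely \<open>exp 1\<close>
  to the gradient bound and 5 to the Lipschitz constant.\<close>

lemma Delta0_ge:
  "272/100 \<le> Delta0 K a"
proof -
  have "(272/100)\<^sup>2 \<le> 2 * 3 * (5/2 :: real)"
    by (simp add: power2_eq_square)
  also have "\<dots> \<le> 2 * pi * exp 1"
    using pi_gt3 exp_one_ge_five_halves by (intro mult_mono) auto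
  finally have "272/100 \<le> sqrt (2 * pi * exp 1)"
    by (rule real_le_rsqrt)
  also have "\<dots> \<le> Delta0 K a"
    unfolding Delta0_def using a by simp
  finally show ?thesis .
qed

lemma gamma_inf_eq: "gamma_inf K a = 6 * exp 1 * Delta0 K a * (r * real K)"
proof -
  have "exp (3/2) = exp 1 * sqrt (exp (1::real))"
    unfolding sqrt_exp_one by (simp flip: exp_add)
  then show ?thesis
    unfolding gamma_inf_def Delta0_def r_def by (simp add: real_sqrt_mult)
qed

lemma ell1_eq: "ell1 K a = 12 * (exp 1)\<^sup>2 * Delta0 K a * (r * real K)\<^sup>2"
proof -
  have "exp (5/2) = (exp 1)\<^sup>2 * sqrt (exp (1::real))"
    unfolding sqrt_exp_one power2_eq_square by (simp flip: exp_add)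
  then show ?thesis
    unfolding ell1_def Delta0_def power_mult_distrib
    using scale_square[OF a] by (simp add: real_sqrt_mult r_def)
qed

text \<open>In units of \<open>P\<close> the \<open>Gam\<close> part costs at most 1 and the product
  part at most 4, by \<open>K + 1 \<le> 2 K\<close>. The target is at least 6 * 5/2 = 15.\<close>

lemma gradient_bound_le_gamma_inf:
  assumes "1 \<le> K"
  shows "exp 1 + (real K + 1) * (2 * r * Delta0 K a) \<le> gamma_inf K a"
proof -
  define P where "P = Delta0 K a * (r * real K)"
  have r: "1 \<le> r"
    using scale_ge_one[OF a] by (simp add: r_def)
  have "1 * 1 \<le> r * real K"
    using r assms by (intro mult_mono) auto
  then have "Delta0 K a * 1 \<le> P"
    unfolding P_def using Delta0_pos by (intro mult_left_mono) auto
  then have "exp 1 \<le> P"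
    using Delta0_ge e_less_272 by linarith
  moreover have "(real K + 1) * (2 * r * Delta0 K a) \<le> (2 * real K) * (2 * r * Delta0 K a)"
    using assms r Delta0_pos by (intro mult_right_mono) auto
  moreover have "(2 * real K) * (2 * r * Delta0 K a) = 4 * P"
    by (simp add: P_def)
  moreover have "6 * (5/2) * P \<le> 6 * exp 1 * P"
    using exp_one_ge_five_halves Delta0_pos r unfolding P_def by (intro mult_right_mono) auto
  moreover have "gamma_inf K a = 6 * exp 1 * P"
    by (simp add: gamma_inf_eq P_def)
  moreover have "0 \<le> P"
    using Delta0_pos r by (simp add: P_def)
  ultimately show ?thesis
    by linarith
qed

text \<open>In units of \<open>P\<close> the \<open>Gam\<close> part costs at most 2 and the product
  part at most 2 * 2 * 16 = 64. The target is at least 12 * (5/2)^2 = 75.\<close>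

lemma lipschitz_bound_le_ell1:
  assumes "1 \<le> K"
  shows "5 + (real K + 1) * (2 * r * Delta0 K a * (14 * r + 2 * r * real K)) \<le> ell1 K a"
proof -
  define P where "P = Delta0 K a * (r * real K)\<^sup>2"
  have r: "1 \<le> r"
    using scale_ge_one[OF a] by (simp add: r_def)
  have "1 * 1 \<le> r * real K"
    using r assms by (intro mult_mono) auto
  then have "1 \<le> (r * real K)\<^sup>2"
    by simp
  then have "Delta0 K a * 1 \<le> P"
    unfolding P_def using Delta0_pos by (intro mult_left_mono) auto
  then have P: "5 \<le> 2 * P"
    using Delta0_ge by linarith
  have "14 * r + 2 * r * real K \<le> 16 * r * real K"
    using r assms by simp
  then have "(real K + 1) * (2 * r * Delta0 K a * (14 * r + 2 * r * real K))
      \<le> (2 * real K) * (2 * r * Delta0 K a * (16 * r * real K))"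
    using r assms Delta0_pos by (intro mult_mono) auto
  moreover have "(2 * real K) * (2 * r * Delta0 K a * (16 * r * real K)) = 64 * P"
    by (simp add: P_def power2_eq_square)
  moreover have "75 * P \<le> 12 * (exp 1)\<^sup>2 * P"
  proof (rule mult_right_mono)
    have "(5/2)\<^sup>2 \<le> (exp (1::real))\<^sup>2"
      using exp_one_ge_five_halves by (rule power_mono) simp
    then show "75 \<le> 12 * (exp (1::real))\<^sup>2"
      by (simp add: power_divide)
  qed (use P in linarith)
  moreover have "ell1 K a = 12 * (exp 1)\<^sup>2 * P"
    by (simp add: ell1_eq P_def)
  ultimately show ?thesis
    using P by linarith
qed

end

section \<open>Assembling the gradient estimates\<close>

lemma L2_set_sum_le:
  assumes "finite I"
  shows "L2_set (\<lambda>i. \<Sum>m\<in>I. f m i) A \<le> (\<Sum>m\<in>I. L2_set (f m) A)"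
  using assms
proof (induction I rule: finite_induct)
  case (insert m I)
  have "L2_set (\<lambda>i. f m i + (\<Sum>m\<in>I. f m i)) A \<le> L2_set (f m) A + L2_set (\<lambda>i. \<Sum>m\<in>I. f m i) A"
    by (rule L2_set_triangle_ineq)
  with insert show ?case
    by (simp add: add_left_mono order_trans)
qed (simp add: L2_set_def)

lemma L2_set_abs_mono:
  assumes "\<And>i. i \<in> A \<Longrightarrow> \<bar>f i\<bar> \<le> g i"
  shows "L2_set f A \<le> L2_set g A"
proof -
  have "L2_set f A = L2_set (\<lambda>i. \<bar>f i\<bar>) A"
    by (simp add: L2_set_def)
  also have "\<dots> \<le> L2_set g A"
    using assms by (intro L2_set_mono) auto
  finally show ?thesis .
qed

context
  fixes e :: "nat \<Rightarrow> 'n::finite" and T K :: nat and a r :: real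
  assumes bij: "bij_betw e {1..T} UNIV"
    and a: "1 < a" "a \<le> exp 1"
  defines "r \<equiv> 1 / sqrt (ln a)"
begin

lemma gradF_component_bound:
  "\<bar>gradF e T K a x $ c\<bar> \<le> exp 1 + (real K + 1) * (2 * r * Delta0 K a)"
proof -
  \<comment> \<open>Writing \<open>int i - int 0\<close> presents the \<open>Gam\<close> family as
    the one with shift 0.\<close>
  have "\<bar>(\<Sum>i = 1..T. dGam (coord e x (int i)) *\<^sub>R coord_dir e (int i - int 0)) $ c\<bar> \<le> exp 1"
    by (rule shifted_sum_component_le[OF bij]) (rule dGam_bound)
  moreover have "\<bar>\<Sum>j\<le>K. (\<Sum>i = 1..T. partial_term e K a x i j *\<^sub>R coord_dir e (int i - int j)) $ c\<bar>
      \<le> (\<Sum>j\<le>K. 2 * r * Delta0 K a)"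
    unfolding r_def
    by (rule order_trans[OF sum_abs sum_mono])
      (intro shifted_sum_component_le[OF bij] partial_term_bound[OF a], simp)
  ultimately show ?thesis
    by (simp add: gradF_def sum_component algebra_simps)
qed

lemma gradF_lipschitz:
  "norm (gradF e T K a x - gradF e T K a y)
    \<le> (5 + (real K + 1) * (2 * r * Delta0 K a * (14 * r + 2 * r * real K))) * norm (x - y)"
proof -
  let ?w = "\<lambda>m i. \<bar>(x - y) \<bullet> coord_dir e (int i - int m)\<bar>"
  let ?g = "\<lambda>i. dGam (coord e x (int i)) - dGam (coord e y (int i))"
  let ?p = "\<lambda>j i. partial_term e K a x i j - partial_term e K a y i j"
  let ?P = "2 * r * Delta0 K a"
  have r: "0 \<le> r"
    using scale_ge_one[OF a] unfolding r_def by linarith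
  have w: "L2_set (?w m) {1..T} \<le> norm (x - y)" for m
    using L2_set_shifted_coord_le[OF bij, of "x - y" m] by (simp add: L2_set_def)
  have "L2_set ?g {1..T} \<le> L2_set (\<lambda>i. 5 * ?w 0 i) {1..T}"
    using dGam_lipschitz by (intro L2_set_abs_mono) (simp flip: coord_diff)
  also have "\<dots> = 5 * L2_set (?w 0) {1..T}"
    by (simp add: L2_set_right_distrib)
  also have "\<dots> \<le> 5 * norm (x - y)"
    using w[of 0] by simp
  finally have g: "L2_set ?g {1..T} \<le> 5 * norm (x - y)" .
  \<comment> \<open>Each coefficient difference is dominated by a combination of the window entries
    \<open>?w m i\<close>. Minkowski's inequality separates the shifts \<open>m\<close>, and each of
    them contributes at most \<open>norm (x - y)\<close>.\<close>
  have p: "L2_set (?p j) {1..T} \<le> ?P * (14 * r + 2 * r * real K) * norm (x - y)"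
    if j: "j \<le> K" for j
  proof -
    have "L2_set (?p j) {1..T}
        \<le> L2_set (\<lambda>i. ?P * (14 * r * ?w j i + (\<Sum>m\<in>{..K} - {j}. 2 * r * ?w m i))) {1..T}"
      using partial_term_diff_bound[OF a j] by (intro L2_set_abs_mono) (simp add: r_def)
    also have "\<dots> = ?P * L2_set (\<lambda>i. 14 * r * ?w j i + (\<Sum>m\<in>{..K} - {j}. 2 * r * ?w m i)) {1..T}"
      using r Delta0_pos[OF a, of K] by (intro L2_set_right_distrib[symmetric]) simp
    also have "\<dots> \<le> ?P * (L2_set (\<lambda>i. 14 * r * ?w j i) {1..T}
        + (\<Sum>m\<in>{..K} - {j}. L2_set (\<lambda>i. 2 * r * ?w m i) {1..T}))"
      using r Delta0_pos[OF a, of K]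
      by (intro mult_left_mono order_trans[OF L2_set_triangle_ineq] add_left_mono L2_set_sum_le) auto
    also have "\<dots> = ?P * (14 * r * L2_set (?w j) {1..T}
        + (\<Sum>m\<in>{..K} - {j}. 2 * r * L2_set (?w m) {1..T}))"
      using r by (simp add: L2_set_right_distrib)
    also have "\<dots> \<le> ?P * (14 * r * norm (x - y) + (\<Sum>m\<in>{..K} - {j}. 2 * r * norm (x - y)))"
      using r Delta0_pos[OF a, of K] w by (intro mult_left_mono add_mono sum_mono) auto
    \<comment> \<open>The set \<open>{..K} - {j}\<close> has exactly \<open>K\<close> elements
      because \<open>j \<le> K\<close>.\<close>
    also have "\<dots> = ?P * (14 * r + 2 * r * real K) * norm (x - y)"
      using j by (simp add: algebra_simps)
    finally show ?thesis .
  qed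
  have diff: "gradF e T K a x - gradF e T K a y
      = (\<Sum>i = 1..T. ?g i *\<^sub>R coord_dir e (int i - int 0))
        - (\<Sum>j\<le>K. \<Sum>i = 1..T. ?p j i *\<^sub>R coord_dir e (int i - int j))"
    by (simp add: gradF_def scaleR_left_diff_distrib sum_subtractf)
  have "norm (gradF e T K a x - gradF e T K a y) \<le> norm (\<Sum>i = 1..T. ?g i *\<^sub>R coord_dir e (int i - int 0))
      + (\<Sum>j\<le>K. norm (\<Sum>i = 1..T. ?p j i *\<^sub>R coord_dir e (int i - int j)))"
    unfolding diff by (intro order_trans[OF norm_triangle_ineq4] add_left_mono norm_sum)
  also have "\<dots> \<le> 5 * norm (x - y) + (\<Sum>j\<le>K. ?P * (14 * r + 2 * r * real K) * norm (x - y))"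
    by (intro add_mono sum_mono order_trans[OF norm_sum_shifted_coord_dir_le[OF bij]] g p) simp
  also have "\<dots> = (5 + (real K + 1) * (?P * (14 * r + 2 * r * real K))) * norm (x - y)"
    by (simp add: algebra_simps)
  finally show ?thesis .
qed

end

theorem lemma3p2:
  fixes T K :: nat and a :: real and e :: "nat \<Rightarrow> 'n::finite"
  assumes "T \<ge> 1" and "K \<ge> 1" and "1 < a" and "a \<le> exp 1"
    and "bij_betw e {1..T} (UNIV :: 'n set)"
  shows "(bdd_below (range (F e T K a))
          \<and> F e T K a 0 - (INF x. F e T K a x) \<le> Delta0 K a * real T)
         \<and> smooth_with (ell1 K a) (F e T K a)
         \<and> (\<forall>x. infnorm (gradient (F e T K a) x) \<le> gamma_inf K a)"
proof (intro conjI allI)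
  note a = assms(3,4)
  \<comment> \<open>Boundedness below guarantees that the real-valued \<open>INF\<close> is the true
    infimum.\<close>
  show "bdd_below (range (F e T K a))"
    by (rule bdd_belowI2) (rule F_ge[OF a(1)])
  have "- (Delta0 K a * real T) \<le> (INF x. F e T K a x)"
    by (intro cINF_greatest F_ge[OF a(1)]) simp
  then show "F e T K a 0 - (INF x. F e T K a x) \<le> Delta0 K a * real T"
    using F_zero_le[of e T K a] by linarith
  show "smooth_with (ell1 K a) (F e T K a)"
    unfolding smooth_with_def gradient_F[OF a(1)]
  proof (intro conjI allI F_gderiv[OF a(1)] lipschitz_onI)
    fix x y :: "real ^ 'n"
    show "dist (gradF e T K a x) (gradF e T K a y) \<le> ell1 K a * dist x y"
      unfolding dist_norm
      by (rule order_trans[OF gradF_lipschitz[OF assms(5) a]])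
        (intro mult_right_mono lipschitz_bound_le_ell1[OF a] assms(2) norm_ge_zero)
  next
    show "0 \<le> ell1 K a"
      using a by (simp add: ell1_def)
  qed
  fix x :: "real ^ 'n"
  show "infnorm (gradient (F e T K a) x) \<le> gamma_inf K a"
    unfolding gradient_F[OF a(1)] infnorm_cart
    by (rule cSup_least)
      (auto intro: order_trans[OF gradF_component_bound[OF assms(5) a]
          gradient_bound_le_gamma_inf[OF a assms(2)]])
qed

end
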